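(* Let $\Omega\subset\mathbb{R}^d$ be compact, let $\mu$ be a (finite) measure on $\Omega$ having a density with respect to Lebesgue measure, let $Y=\{y_1,\dots,y_k\}$ be a set of $k$ points in $\mathbb{R}^d$, let $W=(w_1,\dots,w_k)\in\mathbb{R}^k$ be a weight vector, and let $w_M=\max_i w_i$. For each $i$ let $\hat y_i=(y_i,\sqrt{w_M-w_i})\in\mathbb{R}^{d+1}$, and let $\hat Y=\{\hat y_1,\dots,\hat y_k\}$. Then the quantization noise power $\hat Q(\hat Y)$ of $\hat Y$ computed in $\mathbb{R}^{d+1}$ satisfies $$\hat Q(\hat Y)=f_{T_W}(W)+w_M\,\mu(\Omega).$$
   Context: The space $\mathbb{R}^d$ is identified with the hyperplane of $\mathbb{R}^{d+1}$ where the last coordinate is $0$, through $x\mapsto\hat x=(x,0)$; in particular $\Omega$ and $\mu$ are viewed in this hyperplane. The norm $\|\cdot\|$ is Euclidean. Quantization noise power: $\hat Q(\hat Y)=\int_\Omega \min_i\|\hat x-\hat y_i\|^2\,d\mu(x)=\sum_{i=1}^k\int_{\mathrm{Vor}(\hat y_i)\cap\Omega}\|\hat x-\hat y_i\|^2\,d\mu(x)$, where $\mathrm{Vor}(\hat y_i)=\{z\in\mathbb{R}^{d+1}:\|z-\hat y_i\|^2<\|z-\hat y_j\|^2\ \ \forall j\ne i\}$. Power cells: $\mathrm{Pow}_W(y_i)=\{x\in\mathbb{R}^d:\|x-y_i\|^2-w_i<\|x-y_j\|^2-w_j\ \ \forall j\neq i\}$. The assignment $T_W$ defined by the power diagram is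 the ($\mu$-almost everywhere defined) map $T_W:\Omega\to Y$ with $T_W(x)=y_i$ for $x\in\mathrm{Pow}_W(y_i)\cap\Omega$. For an assignment $T:\Omega\to Y$, $f_T(W)=\int_\Omega\left(\|x-T(x)\|^2-w_{T(x)}\right)d\mu(x)$, where $w_{T(x)}$ means $w_i$ when $T(x)=y_i$. Thus $f_{T_W}(W)=\sum_{i=1}^k\int_{\mathrm{Pow}_W(y_i)\cap\Omega}\left(\|x-y_i\|^2-w_i\right)d\mu(x)$. (The function maximized by the weight vector defining the semi-discrete optimal transport map from $\mu$ to $\sum_i\nu_i\delta_{y_i}$ is $g(W)=f_{T_W}(W)+\sum_i\nu_i w_i$.) *)

theory Defs
  imports "HOL-Analysis.Analysis"
begin

text \<open>
  \<open>\<real>\<^sup>d\<close> is \<^typ>\<open>real ^ 'd\<close> and \<open>\<real>\<^sup>d\<^sup>+\<^sup>1\<close> is \<^typ>\<open>(real ^ 'd) \<times> real\<close>, whose library norm is the Euclidean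
  one. Sites and weights are indexed by a finite type \<open>'k\<close> with \<open>k\<close> elements.
\<close>

definition embed :: "real ^ 'd \<Rightarrow> (real ^ 'd) \<times> real"
  where "embed x = (x, 0)"

definition quantization_noise_power ::
    "(real ^ 'd) set \<Rightarrow> (real ^ 'd) measure \<Rightarrow> ((real ^ 'd) \<times> real) set \<Rightarrow> real"
  where "quantization_noise_power \<Omega> \<mu> Q =
    (LINT x:\<Omega>|\<mu>. (MIN q\<in>Q. (norm (embed x - q))\<^sup>2))"

definition power_cell ::
    "('k::finite \<Rightarrow> real ^ 'd) \<Rightarrow> real ^ 'k \<Rightarrow> 'k \<Rightarrow> (real ^ 'd) set"
  where "power_cell y w i =
    {x. \<forall>j. j \<noteq> i \<longrightarrow> (norm (x - y i))\<^sup>2 - w $ i < (norm (x - y j))\<^sup>2 - w $ j}"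

text \<open>
  The cells are pairwise disjoint, so the index below is unique where it exists. On the
  complement of the union of the cells (a Lebesgue null set when \<open>y\<close> is injective) the value is
  one fixed, unspecified site.
\<close>

definition power_assignment ::
    "('k::finite \<Rightarrow> real ^ 'd) \<Rightarrow> real ^ 'k \<Rightarrow> real ^ 'd \<Rightarrow> real ^ 'd"
  where "power_assignment y w x = y (THE i. x \<in> power_cell y w i)"

text \<open>
  For injective \<open>y\<close>, the index \<open>inv y (T x)\<close> is the \<open>i\<close> with \<open>T x = y i\<close>, so that
  \<open>w $ inv y (T x)\<close> is the weight of the site \<open>T x\<close>.
\<close>

definition assignment_cost ::
    "(real ^ 'd) set \<Rightarrow> (real ^ 'd) measure \<Rightarrow> ('k::finite \<Rightarrow> real ^ 'd) \<Rightarrow>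
      (real ^ 'd \<Rightarrow> real ^ 'd) \<Rightarrow> real ^ 'k \<Rightarrow> real"
  where "assignment_cost \<Omega> \<mu> y T w =
    (LINT x:\<Omega>|\<mu>. (norm (x - T x))\<^sup>2 - w $ inv y (T x))"

definition max_weight :: "real ^ 'k::finite \<Rightarrow> real"
  where "max_weight w = (MAX i. w $ i)"

definition lifted_site ::
    "('k::finite \<Rightarrow> real ^ 'd) \<Rightarrow> real ^ 'k \<Rightarrow> 'k \<Rightarrow> (real ^ 'd) \<times> real"
  where "lifted_site y w i = (y i, sqrt (max_weight w - w $ i))"

end

(* The squared distance from (x, 0) to the i-th lifted site is the power distance
   |x - y_i|^2 - w_i plus the constant w_M, so the quantization integrand is the minimal power
   distance plus w_M. The assignment attains that minimum on the power cells, whose complement lies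
   in the finitely many hyperplanes on which two power distances agree. *)

theory Submission imports Defs
begin

definition power_dist :: "('k \<Rightarrow> real ^ 'd) \<Rightarrow> real ^ 'k \<Rightarrow> 'k \<Rightarrow> real ^ 'd \<Rightarrow> real"
  where "power_dist y w i x = (norm (x - y i))\<^sup>2 - w $ i"

lemma continuous_on_power_dist [continuous_intros]: "continuous_on S (power_dist y w i)"
  unfolding power_dist_def by (intro continuous_intros)

lemma power_cell_eq: "power_cell y w i = {x. \<forall>j. j \<noteq> i \<longrightarrow> power_dist y w i x < power_dist y w j x}"
  by (simp add: power_cell_def power_dist_def)

lemma open_power_cell: "open (power_cell y w i)"
proof -
  have "power_cell y w i = (\<Inter>j\<in>-{i}. {x. power_dist y w i x < power_dist y w j x})"
    by (auto simp: power_cell_eq)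
  then show ?thesis
    by (auto intro!: open_INT open_Collect_less continuous_intros)
qed

text \<open>Two cells containing \<open>x\<close> would give strict inequalities between the same
  two power distances in both directions.\<close>

lemma The_power_cell:
  assumes "x \<in> power_cell y w i"
  shows "(THE i. x \<in> power_cell y w i) = i"
  using assms by (intro the_equality) (auto simp: power_cell_eq dest: less_asym)

lemma Min_power_dist_cell:
  assumes "x \<in> power_cell y w i"
  shows "(MIN j. power_dist y w j x) = power_dist y w i x"
  using assms by (intro Min_eqI) (auto simp: power_cell_eq intro: less_imp_le)

lemma negligible_power_dist_eq:
  assumes "y i \<noteq> y j"
  shows "negligible {x. power_dist y w i x = power_dist y w j x}"
proof -
  \<comment> \<open>The quadratic term \<open>x \<bullet> x\<close> cancels, leaving an affine
    equation with normal \<open>2 *\<^sub>R (y j - y i)\<close>, which is nonzero because the two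
    sites differ.\<close>
  have "{x. power_dist y w i x = power_dist y w j x} =
      {x. (2 *\<^sub>R (y j - y i)) \<bullet> x = (y j) \<bullet> (y j) - w $ j - ((y i) \<bullet> (y i) - w $ i)}"
    by (auto simp: power_dist_def power2_norm_eq_inner inner_diff_left inner_diff_right
        inner_commute algebra_simps)
  then show ?thesis
    using assms by (auto simp only: intro!: negligible_hyperplane) simp
qed

lemma negligible_Compl_power_cells:
  assumes "inj y"
  shows "negligible (- (\<Union>i. power_cell y w i))"
proof (rule negligible_subset)
  show "negligible (\<Union>(i, j)\<in>{(i, j). i \<noteq> j}. {x. power_dist y w i x = power_dist y w j x})"
    using assms by (intro negligible_Union) (auto intro!: negligible_power_dist_eq dest: injD)
  show "- (\<Union>i. power_cell y w i) \<subseteq>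
      (\<Union>(i, j)\<in>{(i, j). i \<noteq> j}. {x. power_dist y w i x = power_dist y w j x})"
  proof
    fix x assume x: "x \<in> - (\<Union>i. power_cell y w i)"
    \<comment> \<open>Take \<open>i\<close> minimizing the power distance at \<open>x\<close>. Since
      \<open>x\<close> is not in cell \<open>i\<close>, some other \<open>j\<close> does at least as
      well, so \<open>i\<close> and \<open>j\<close> tie.\<close>
    have "(MIN i. power_dist y w i x) \<in> range (\<lambda>i. power_dist y w i x)"
      by (rule Min_in) auto
    then obtain i where i: "power_dist y w i x = (MIN i. power_dist y w i x)"
      by (metis imageE)
    then have "power_dist y w i x \<le> power_dist y w j x" for j
      by simp
    moreover from x obtain j where "j \<noteq> i" "\<not> power_dist y w i x < power_dist y w j x"
      by (auto simp: power_cell_eq)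
    ultimately show "x \<in> (\<Union>(i, j)\<in>{(i, j). i \<noteq> j}. {x. power_dist y w i x = power_dist y w j x})"
      by (force intro: antisym simp: not_less)
  qed
qed

text \<open>The cells are open, so the complement of their union is Borel. This turns Lebesgue
  negligibility into nullity for \<open>lborel\<close> itself, which passes to the restriction and
  then to the density.\<close>

lemma AE_density_restrict_lborel_power_cells:
  assumes "inj y" and "\<Omega> \<in> sets borel" and "\<rho> \<in> borel_measurable (restrict_space lborel \<Omega>)"
  shows "AE x in density (restrict_space lborel \<Omega>) \<rho>. x \<in> (\<Union>i. power_cell y w i)"
proof -
  have "- (\<Union>i. power_cell y w i) \<in> sets borel"
    by (intro borel_closed closed_Compl open_UN) (auto intro: open_power_cell)
  with negligible_Compl_power_cells[OF assms(1), of w]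
  have "- (\<Union>i. power_cell y w i) \<in> null_sets lborel"
    by (simp add: negligible_iff_null_sets null_sets_completion_iff)
  then have "AE x in lborel. x \<in> (\<Union>i. power_cell y w i)"
    by (rule AE_I') auto
  then have "AE x in restrict_space lborel \<Omega>. x \<in> (\<Union>i. power_cell y w i)"
    using assms(2) by (subst AE_restrict_space_iff) auto
  then show ?thesis
    using assms(3) by (subst AE_density) auto
qed

text \<open>By Pythagoras the last coordinate adds the square of
  \<open>sqrt (max_weight w - w $ i)\<close>. The radicand is nonnegative by maximality, so this
  square is \<open>max_weight w - w $ i\<close>.\<close>

lemma norm_embed_lifted_site:
  "(norm (embed x - lifted_site y w i))\<^sup>2 = power_dist y w i x + max_weight w"
proof -
  have "w $ i \<le> max_weight w"
    by (simp add: max_weight_def)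
  then show ?thesis
    by (simp add: embed_def lifted_site_def power_dist_def norm_Pair)
qed

lemma Min_norm_embed_lifted_site:
  "(MIN q\<in>range (lifted_site y w). (norm (embed x - q))\<^sup>2) =
    (MIN i. power_dist y w i x) + max_weight w"
  by (simp add: image_image norm_embed_lifted_site Min_add_commute)

lemma continuous_on_Min:
  fixes f :: "'i \<Rightarrow> 'a::topological_space \<Rightarrow> 'b::linorder_topology"
  assumes "finite I" "I \<noteq> {}" "\<And>i. i \<in> I \<Longrightarrow> continuous_on S (f i)"
  shows "continuous_on S (\<lambda>x. MIN i\<in>I. f i x)"
  using assms by (induction I rule: finite_ne_induct) (auto intro: continuous_on_min)

theorem mainTheorem2:
  fixes \<Omega> :: "(real ^ 'd) set"
    and \<mu> :: "(real ^ 'd) measure"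
    and \<rho> :: "real ^ 'd \<Rightarrow> ennreal"
    and y :: "'k::finite \<Rightarrow> real ^ 'd"
    and w :: "real ^ 'k"
  assumes "compact \<Omega>"
    and "finite_measure \<mu>"
    and "\<rho> \<in> borel_measurable (restrict_space lborel \<Omega>)"
    and "\<mu> = density (restrict_space lborel \<Omega>) \<rho>"
    and "inj y"
  shows "quantization_noise_power \<Omega> \<mu> (range (lifted_site y w)) =
    assignment_cost \<Omega> \<mu> y (power_assignment y w) w + max_weight w * measure \<mu> \<Omega>"
proof -
  interpret finite_measure \<mu> by fact
  define m where "m x = (MIN i. power_dist y w i x)" for x
  define T where "T = power_assignment y w"
  define cost where "cost x = (norm (x - T x))\<^sup>2 - w $ inv y (T x)" for x
  have \<Omega>: "\<Omega> \<in> sets borel"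
    using assms(1) by (simp add: borel_compact)
  have sets_\<mu>: "sets \<mu> = sets (restrict_space borel \<Omega>)"
    using assms(4) by (simp add: sets_restrict_space)
  have space_\<mu>: "space \<mu> = \<Omega>"
    using assms(4) by (simp add: space_restrict_space)
  have borel_\<mu>: "f \<in> borel_measurable \<mu>" if "f \<in> borel_measurable borel" for f :: "_ \<Rightarrow> real"
    using that measurable_restrict_space1 measurable_cong_sets[OF sets_\<mu> refl] by blast
  have cont_m: "continuous_on S m" for S
    unfolding m_def by (intro continuous_on_Min continuous_on_power_dist) auto
  have m_borel: "m \<in> borel_measurable borel"
    by (rule borel_measurable_continuous_onI[OF cont_m])
  \<comment> \<open>A continuous function is bounded on the compact \<Omega>, and \<mu> is
    finite.\<close>
  have int_m: "integrable \<mu> m"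
  proof -
    have "bounded (m ` \<Omega>)"
      using assms(1) cont_m by (intro compact_imp_bounded compact_continuous_image)
    then obtain B where "\<And>x. x \<in> \<Omega> \<Longrightarrow> norm (m x) \<le> B"
      by (auto simp: bounded_iff)
    then show ?thesis
      using space_\<mu> by (intro integrable_const_bound[of _ B] AE_I2 borel_\<mu> m_borel) auto
  qed
  \<comment> \<open>Injectivity lets \<open>inv y\<close> recover the index chosen by
    \<open>THE\<close>, for every \<open>x\<close>, on or off the cells.\<close>
  have cost_dist: "cost x = power_dist y w (THE i. x \<in> power_cell y w i) x" for x
    using assms(5) by (simp add: cost_def T_def power_assignment_def power_dist_def)
  have cost_cell: "cost x = m x" if "x \<in> power_cell y w i" for x i
    using that by (simp add: cost_dist m_def The_power_cell Min_power_dist_cell)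
  \<comment> \<open>Off the cells \<open>THE\<close> yields one fixed index, so the cost is Borel there as well; \<open>\<mu>\<close> need not
    be complete, so almost everywhere equality with \<open>m\<close> would not give this.\<close>
  have "cost = (\<lambda>x. if x \<in> (\<Union>i. power_cell y w i) then m x
      else power_dist y w (THE i. False) x)"
    by (rule ext) (auto simp: cost_cell, simp add: cost_dist)
  also have "\<dots> \<in> borel_measurable borel"
    by (intro measurable_If_set m_borel borel_measurable_continuous_onI continuous_intros)
      (auto intro!: borel_open open_UN open_power_cell)
  finally have cost_borel: "cost \<in> borel_measurable borel" .
  have "AE x in \<mu>. x \<in> (\<Union>i. power_cell y w i)"
    unfolding assms(4) using assms(5) \<Omega> assms(3) by (rule AE_density_restrict_lborel_power_cells)
  then have cost_m: "(LINT x|\<mu>. cost x) = (LINT x|\<mu>. m x)"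
    by (intro integral_cong_AE borel_\<mu> cost_borel m_borel) (auto elim!: eventually_mono simp: cost_cell)
  \<comment> \<open>The space of \<mu> is \<Omega>, so the indicator of \<Omega> equals 1 throughout
    the domain of integration.\<close>
  have set_int: "(LINT x:\<Omega>|\<mu>. f x) = (LINT x|\<mu>. f x)" for f :: "_ \<Rightarrow> real"
    unfolding set_lebesgue_integral_def using space_\<mu> by (intro Bochner_Integration.integral_cong) auto
  have "quantization_noise_power \<Omega> \<mu> (range (lifted_site y w)) = (LINT x|\<mu>. m x + max_weight w)"
    by (simp only: quantization_noise_power_def Min_norm_embed_lifted_site set_int m_def)
  \<comment> \<open>Integrability of \<open>m\<close> and finiteness of \<mu> allow the sum to be
    split.\<close>
  also have "\<dots> = (LINT x|\<mu>. m x) + max_weight w * measure \<mu> \<Omega>"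
    using int_m space_\<mu> by simp
  finally show ?thesis
    using cost_m by (simp add: assignment_cost_def set_int cost_def T_def)
qed

end
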